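(* For all sufficiently large integers $d$, \[ d\bigl(\log_2(d) - 4 \log_2(\log_2(d))\bigr) \leq \mathrm{VC}(\mathcal{C}^d_{\mathrm{per}}) \leq \mathrm{VC}(\mathcal{B}^d_{\mathrm{per}}) \leq d\bigl(\log_2(d) + 3 \log_2(\log_2(d))\bigr). \] In particular $\mathrm{VC}(\mathcal{B}^d_{\mathrm{per}}) \sim \mathrm{VC}(\mathcal{C}^d_{\mathrm{per}}) \sim d \log_2(d)$ as $d\to\infty$.
   Context: For a family $H$ of sets and a set $C$, let $H\cap C=\{h\cap C: h\in H\}$; $H$ shatters $C$ if $|H\cap C|=2^{|C|}$. The VC-dimension $\mathrm{VC}(H)$ is the largest integer $D$ such that some set $C$ of cardinality $D$ is shattered by $H$. The torus $\mathbb{T}$ is $[0,1]$ with $0$ and $1$ identified. For $a<b$ the interval $[a,b]$ is the usual one, of length $b-a$; for $a>b$, $[a,b]:=[0,b]\cup[a,1]$, of length $1-a+b$. $\mathcal{B}^d_{\mathrm{per}}$ is the set of $d$-dimensional axis-parallel boxes in the torus $\mathbb{T}^d$: $\mathcal{B}^d_{\mathrm{per}}=\{[a_1,b_1]\times\cdots\times[a_d,b_d] : 0\le a_i\ne b_i\le 1 \text{ for all } i\}$. $\mathcal{C}^d_{\mathrm{per}}\subseteq \mathcal{B}^d_{\mathrm{per}}$ is the set of axis-parallel cubes, i.e. boxes in which all $d$ intervals have the same length. $f\sim g$ means $f(x)/g(x)\to 1$. *)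

theory Defs
  imports Complex_Main "HOL-Library.FuncSet" "HOL-Library.Landau_Symbols"
begin

definition vc_trace :: "'a set set \<Rightarrow> 'a set \<Rightarrow> 'a set set" where
  "vc_trace H C = {h \<inter> C | h. h \<in> H}"

text \<open>Finiteness is explicit because \<^const>\<open>card\<close> is 0 on infinite sets.\<close>

definition shatters :: "'a set set \<Rightarrow> 'a set \<Rightarrow> bool" where
  "shatters H C \<longleftrightarrow> finite C \<and> card (vc_trace H C) = 2 ^ card C"

text \<open>
  If there is no largest such \<open>D\<close>, the value is one fixed unspecified natural number, the same
  for all such families over the same type. A lower bound that tends to infinity along a sequence
  of families therefore implies that a largest \<open>D\<close> exists from some point on.
\<close>

definition VC :: "'a set set \<Rightarrow> nat" where
  "VC H = (GREATEST D. \<exists>C. card C = D \<and> shatters H C)"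

definition torus_eq :: "real \<Rightarrow> real \<Rightarrow> bool" where
  "torus_eq x y \<longleftrightarrow> x \<in> {0..1} \<and> y \<in> {0..1} \<and> (x = y \<or> {x, y} = {0, 1})"

text \<open>The quotient is partial: only the points of the unit interval represent torus points.\<close>

quotient_type torus = real / partial: torus_eq
proof (rule part_equivpI)
  show "\<exists>x. torus_eq x x"
    by (rule exI[of _ 0]) (simp add: torus_eq_def)
  show "symp torus_eq"
    by (auto simp: symp_def torus_eq_def)
  show "transp torus_eq"
    by (auto simp: transp_def torus_eq_def doubleton_eq_iff)
qed

definition per_interval :: "real \<Rightarrow> real \<Rightarrow> torus set" where
  "per_interval a b = abs_torus ` (if a < b then {a..b} else {0..b} \<union> {a..1})"

definition per_length :: "real \<Rightarrow> real \<Rightarrow> real" where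
  "per_length a b = (if a < b then b - a else 1 - a + b)"

definition per_endpoints :: "nat \<Rightarrow> (nat \<Rightarrow> real) \<Rightarrow> (nat \<Rightarrow> real) \<Rightarrow> bool" where
  "per_endpoints d a b \<longleftrightarrow> (\<forall>i<d. a i \<in> {0..1} \<and> b i \<in> {0..1} \<and> a i \<noteq> b i)"

text \<open>
  A point of the \<open>d\<close>-dimensional torus is an extensional function on \<open>{..<d}\<close>, that is,
  an element of \<open>{..<d} \<rightarrow>\<^sub>E UNIV\<close>.
\<close>

definition per_box :: "nat \<Rightarrow> (nat \<Rightarrow> real) \<Rightarrow> (nat \<Rightarrow> real) \<Rightarrow> (nat \<Rightarrow> torus) set" where
  "per_box d a b = (\<Pi>\<^sub>E i\<in>{..<d}. per_interval (a i) (b i))"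

definition per_boxes :: "nat \<Rightarrow> (nat \<Rightarrow> torus) set set" where
  "per_boxes d = {per_box d a b | a b. per_endpoints d a b}"

definition per_cubes :: "nat \<Rightarrow> (nat \<Rightarrow> torus) set set" where
  "per_cubes d = {per_box d a b | a b. per_endpoints d a b \<and>
     (\<forall>i<d. \<forall>j<d. per_length (a i) (b i) = per_length (a j) (b j))}"

end

theory Submission
  imports Defs "HOL-Real_Asymp.Real_Asymp"
begin

text \<open>
  Upper bound. In one coordinate the complement of a trace on \<open>N\<close> points is a contiguous arc of their
  cyclic order. An arc of logarithmic length is missed by few subsets, so at least half of the subsets
  of a shattered set are determined by \<open>d\<close> arcs of length less than \<open>L = O(log d)\<close>. This gives
  \<open>2 ^ (N - 1) \<le> (N L) ^ d\<close>, where counting all arcs would only give a bound of about \<open>2 d log d\<close>.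

  Lower bound. Split the points into \<open>G\<close> groups of size \<open>R\<close>, with \<open>G\<close> slightly below \<open>d\<close> and \<open>2 ^ R\<close> equal
  to \<open>d\<close> up to a power of \<open>log d\<close>. Each of \<open>G + z\<close> coordinates picks a random subset of every group
  and can then realise, for one group of its choice, exactly this subset, all other groups being
  untouched. A maximal matching between the groups and the coordinates that realise the prescribed
  trace leaves fewer than \<open>x\<close> groups unmatched, for all prescribed traces at once, because a random
  colouring has no large avoided rectangle. The fewer than \<open>x R\<close> points left over are removed one by
  one in the remaining coordinates. All omitted arcs have the same length, so cubes suffice.
\<close>

section \<open>Shattering\<close>

lemma shatters_iff: "shatters H C \<longleftrightarrow> finite C \<and> vc_trace H C = Pow C"
proof -
  have "vc_trace H C \<subseteq> Pow C"
    by (auto simp: vc_trace_def)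
  then show ?thesis
    unfolding shatters_def by (metis card_Pow card_subset_eq finite_Pow_iff)
qed

lemma shatters_subset:
  assumes "shatters H C" "C' \<subseteq> C"
  shows "shatters H C'"
proof -
  have "A \<in> vc_trace H C'" if "A \<subseteq> C'" for A
  proof -
    have "A \<in> vc_trace H C"
      using that assms by (auto simp: shatters_iff)
    then obtain h where "h \<in> H" "A = h \<inter> C"
      by (auto simp: vc_trace_def)
    then have "A = h \<inter> C'"
      using that assms(2) by auto
    with \<open>h \<in> H\<close> show ?thesis
      by (auto simp: vc_trace_def)
  qed
  moreover have "vc_trace H C' \<subseteq> Pow C'"
    by (auto simp: vc_trace_def)
  ultimately show ?thesis
    using assms by (auto simp: shatters_iff intro: finite_subset)
qed

lemma shatters_mono:
  assumes "shatters H C" "H \<subseteq> H'"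
  shows "shatters H' C"
proof -
  have "vc_trace H C \<subseteq> vc_trace H' C" "vc_trace H' C \<subseteq> Pow C"
    using assms(2) by (auto simp: vc_trace_def)
  with assms(1) show ?thesis
    by (auto simp: shatters_iff)
qed

text \<open>Lets a shattered set be given by parameters \<open>p\<close>. Injectivity of
  \<open>q\<close> comes for free: the member of \<open>H\<close> that picks out \<open>p\<close>
  alone tells \<open>q p\<close> apart from the other values.\<close>

lemma shatters_image:
  assumes "finite P" and sep: "\<And>A. A \<subseteq> P \<Longrightarrow> \<exists>h\<in>H. \<forall>p\<in>P. q p \<in> h \<longleftrightarrow> p \<in> A"
  shows "shatters H (q ` P)" "card (q ` P) = card P"
proof -
  have "inj_on q P"
  proof (rule inj_onI)
    fix p p' assume p: "p \<in> P" "p' \<in> P" "q p = q p'"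
    obtain h where "\<forall>x\<in>P. q x \<in> h \<longleftrightarrow> x \<in> {p}"
      using sep[of "{p}"] p by auto
    with p show "p = p'"
      by (metis singletonD singletonI)
  qed
  then show "card (q ` P) = card P"
    by (rule card_image)
  have "A \<in> vc_trace H (q ` P)" if "A \<subseteq> q ` P" for A
  proof -
    obtain h where "h \<in> H" "\<forall>p\<in>P. q p \<in> h \<longleftrightarrow> p \<in> {p\<in>P. q p \<in> A}"
      using sep[of "{p\<in>P. q p \<in> A}"] by auto
    then have "A = h \<inter> q ` P"
      using that by auto
    with \<open>h \<in> H\<close> show ?thesis
      by (auto simp: vc_trace_def)
  qed
  then show "shatters H (q ` P)"
    using \<open>finite P\<close> by (auto simp: shatters_iff vc_trace_def)
qed

text \<open>\<open>GREATEST\<close> is a true maximum only for a bounded property; the second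
  premise supplies a bound, and any bound will do.\<close>

lemma VC_ge:
  assumes "shatters H C" and "\<And>C. shatters H C \<Longrightarrow> card C \<le> b"
  shows "card C \<le> VC H"
  unfolding VC_def
proof (rule Greatest_le_nat[where b = b])
  show "\<exists>C'. card C' = card C \<and> shatters H C'"
    using assms(1) by blast
  show "D \<le> b" if "\<exists>C. card C = D \<and> shatters H C" for D
    using that assms(2) by blast
qed

text \<open>For nonempty \<open>H\<close> the empty set is shattered, so together with the bound the
  maximum exists and is attained.\<close>

lemma VC_le:
  assumes "H \<noteq> {}" and "\<And>C. shatters H C \<Longrightarrow> card C \<le> b"
  shows "VC H \<le> b"
proof -
  have "shatters H {}"
    using assms(1) by (auto simp: shatters_iff vc_trace_def)
  then have "\<exists>D C. card C = D \<and> shatters H C"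
    by blast
  then have "\<exists>C. card C = VC H \<and> shatters H C"
    unfolding VC_def by (rule GreatestI_ex_nat[where b = b]) (use assms in auto)
  with assms(2) show ?thesis
    by metis
qed

lemma VC_mono:
  assumes "H \<subseteq> H'" "H \<noteq> {}" and "\<And>C. shatters H' C \<Longrightarrow> card C \<le> b"
  shows "VC H \<le> VC H'"
proof (rule VC_le[OF assms(2)])
  fix C assume "shatters H C"
  then have "shatters H' C"
    using assms(1) by (rule shatters_mono)
  then show "card C \<le> VC H'"
    using assms(3) by (rule VC_ge)
qed

section \<open>Intervals on the torus\<close>

lemma abs_torus_eq_iff:
  assumes "x \<in> {0..1}" "y \<in> {0..1}"
  shows "abs_torus x = abs_torus y \<longleftrightarrow> torus_eq x y"
  using Quotient3_rel[OF Quotient3_torus, of x y] assms by (auto simp: torus_eq_def)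

text \<open>Representatives in the half-open interval allow torus points to be sorted as reals; the
  representative \<open>1\<close> is traded for \<open>0\<close>.\<close>

lemma ex_abs_torus: "\<exists>x\<in>{0..<1}. t = abs_torus x"
proof -
  define y where "y = rep_torus t"
  have y: "abs_torus y = t" "y \<in> {0..1}"
    using Quotient3_abs_rep[OF Quotient3_torus] Quotient3_rep_reflp[OF Quotient3_torus, of t]
    by (auto simp: y_def torus_eq_def)
  show ?thesis
  proof (cases "y = 1")
    case True
    have "abs_torus 0 = abs_torus 1"
      by (subst abs_torus_eq_iff) (auto simp: torus_eq_def)
    with y True show ?thesis
      by (intro bexI[of _ 0]) auto
  next
    case False
    with y show ?thesis
      by (intro bexI[of _ y]) auto
  qed
qed

text \<open>The disjunct \<open>x = 0 \<and> b = 1\<close> is the gluing of \<open>0\<close> and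
  \<open>1\<close>: an unwrapped interval that reaches \<open>1\<close> contains the point
  \<open>0\<close>. A wrapped one contains it anyway, because \<open>0 \<le> b\<close>.\<close>

lemma abs_torus_in_per_interval:
  assumes "x \<in> {0..<1}" "a \<in> {0..1}" "b \<in> {0..1}" "a \<noteq> b"
  shows "abs_torus x \<in> per_interval a b \<longleftrightarrow>
    (if a < b then a \<le> x \<and> x \<le> b \<or> x = 0 \<and> b = 1 else x \<le> b \<or> a \<le> x)"
proof -
  have img: "abs_torus x \<in> abs_torus ` Y \<longleftrightarrow> x \<in> Y \<or> x = 0 \<and> 1 \<in> Y" if "Y \<subseteq> {0..1}" for Y
  proof -
    have "abs_torus x \<in> abs_torus ` Y \<longleftrightarrow> (\<exists>y\<in>Y. torus_eq x y)"
      unfolding image_iff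
    proof (rule bex_cong[OF refl])
      fix y assume "y \<in> Y"
      with that assms(1) show "abs_torus x = abs_torus y \<longleftrightarrow> torus_eq x y"
        by (intro abs_torus_eq_iff) auto
    qed
    also have "\<dots> \<longleftrightarrow> (\<exists>y\<in>Y. y = x \<or> x = 0 \<and> y = 1)"
    proof (rule bex_cong[OF refl])
      fix y assume "y \<in> Y"
      with that assms(1) show "torus_eq x y \<longleftrightarrow> y = x \<or> x = 0 \<and> y = 1"
        by (auto simp: torus_eq_def doubleton_eq_iff)
    qed
    also have "\<dots> \<longleftrightarrow> x \<in> Y \<or> x = 0 \<and> 1 \<in> Y"
      by auto
    finally show ?thesis .
  qed
  show ?thesis
    unfolding per_interval_def using assms by (subst img) auto
qed

section \<open>Upper bound\<close>

definition arc :: "nat \<Rightarrow> nat \<Rightarrow> nat \<Rightarrow> nat set" where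
  "arc N k l = (\<lambda>j. (k + j) mod N) ` {..<l}"

lemma arc_mono: "l \<le> l' \<Longrightarrow> arc N k l \<subseteq> arc N k l'"
  unfolding arc_def by (rule image_mono) auto

lemma arc_subset: "0 < N \<Longrightarrow> arc N k l \<subseteq> {..<N}"
  by (auto simp: arc_def)

lemma mod_less_double:
  fixes x N :: nat
  shows "x < 2 * N \<Longrightarrow> x mod N = (if x < N then x else x - N)"
  by (simp add: le_mod_geq)

lemma card_arc:
  assumes "k < N" "l \<le> N"
  shows "card (arc N k l) = l"
proof -
  have "inj_on (\<lambda>j. (k + j) mod N) {..<l}"
    using assms by (auto intro!: inj_onI simp: mod_less_double split: if_splits)
  then show ?thesis
    by (simp add: arc_def card_image)
qed

lemma ex_arc_between:
  assumes "m \<le> N" "m' \<le> N" "0 < N"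
  shows "\<exists>k<N. \<exists>l\<le>N. arc N k l = {m..<m'}"
proof (cases "m < m'")
  case True
  have "arc N m (m' - m) = (\<lambda>j. m + j) ` {..<m' - m}"
    unfolding arc_def using assms by (intro image_cong) auto
  also have "\<dots> = {m..<m'}"
    using True by (simp add: lessThan_atLeast0)
  finally have "arc N m (m' - m) = {m..<m'}" .
  moreover have "m < N" "m' - m \<le> N"
    using True assms by auto
  ultimately show ?thesis
    by blast
next
  case False
  then have "arc N 0 0 = {m..<m'}"
    by (simp add: arc_def)
  with \<open>0 < N\<close> show ?thesis
    by blast
qed

lemma ex_arc_outside:
  assumes "m \<le> m'" "m' \<le> N" "0 < N"
  shows "\<exists>k<N. \<exists>l\<le>N. arc N k l = {..<m} \<union> {m'..<N}"
proof (cases "m' < N")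
  case True
  \<comment> \<open>Starting at \<open>m'\<close>, the first \<open>N - m'\<close> positions run up
    to \<open>N - 1\<close>; the next \<open>m\<close> wrap around to the beginning.\<close>
  have "arc N m' (N - m' + m) = {..<m} \<union> {m'..<N}" (is "?L = ?R")
  proof
    show "?L \<subseteq> ?R"
      using assms True by (auto simp: arc_def mod_less_double)
    show "?R \<subseteq> ?L"
    proof
      fix i assume "i \<in> ?R"
      then show "i \<in> ?L"
        unfolding arc_def
      proof (elim UnE)
        assume "i \<in> {..<m}"
        then show "i \<in> (\<lambda>j. (m' + j) mod N) ` {..<N - m' + m}"
          using assms True by (intro image_eqI[of _ _ "N - m' + i"]) (auto simp: mod_less_double)
      next
        assume "i \<in> {m'..<N}"
        then show "i \<in> (\<lambda>j. (m' + j) mod N) ` {..<N - m' + m}"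
          using assms True by (intro image_eqI[of _ _ "i - m'"]) auto
      qed
    qed
  qed
  moreover have "N - m' + m \<le> N"
    using assms by auto
  ultimately show ?thesis
    using True by blast
next
  case False
  then show ?thesis
    using ex_arc_between[of 0 N m] assms by (simp add: lessThan_atLeast0)
qed

text \<open>Translates a threshold on sorted real values into a cut \<open>m\<close> between
  indices.\<close>

lemma initial_segment_nat:
  fixes P :: "nat \<Rightarrow> bool"
  assumes "\<And>i j. i \<le> j \<Longrightarrow> j < N \<Longrightarrow> P j \<Longrightarrow> P i"
  shows "\<exists>m\<le>N. \<forall>i<N. P i \<longleftrightarrow> i < m"
  using assms
proof (induction N)
  case 0
  show ?case
    by simp
next
  case (Suc N)
  then obtain m where m: "m \<le> N" "\<forall>i<N. P i \<longleftrightarrow> i < m"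
    by (meson less_SucI)
  show ?case
  proof (cases "P N")
    case True
    have "P i" if "i < Suc N" for i
      by (rule Suc.prems[OF _ _ True]) (use that in simp_all)
    then show ?thesis
      by blast
  next
    case False
    with m have "\<forall>i<Suc N. P i \<longleftrightarrow> i < m"
      by (simp add: less_Suc_eq)
    with m(1) show ?thesis
      using le_SucI by blast
  qed
qed

text \<open>For sorted \<open>u\<close>, each of the conditions \<open>u i < a\<close>,
  \<open>u i \<le> b\<close> and \<open>u i \<le> 0\<close> holds exactly on an initial segment of
  indices. The missed indices lie between two such cuts or outside them, hence form an arc.\<close>

lemma per_interval_complement_arc:
  fixes u :: "nat \<Rightarrow> real"
  assumes u: "\<And>i. i < N \<Longrightarrow> u i \<in> {0..<1}" and mono: "\<And>i j. i \<le> j \<Longrightarrow> j < N \<Longrightarrow> u i \<le> u j"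
    and ab: "a \<in> {0..1}" "b \<in> {0..1}" "a \<noteq> b" and "0 < N"
  shows "\<exists>k<N. \<exists>l\<le>N. {i. i < N \<and> abs_torus (u i) \<notin> per_interval a b} = arc N k l"
proof -
  have lt: "\<exists>m\<le>N. \<forall>i<N. u i < y \<longleftrightarrow> i < m" for y
    by (rule initial_segment_nat) (use mono in force)
  have le: "\<exists>m\<le>N. \<forall>i<N. u i \<le> y \<longleftrightarrow> i < m" for y
    by (rule initial_segment_nat) (use mono in force)
  have mem: "abs_torus (u i) \<notin> per_interval a b \<longleftrightarrow>
      (if a < b then (u i < a \<or> \<not> u i \<le> b) \<and> (b = 1 \<longrightarrow> \<not> u i \<le> 0) else \<not> u i \<le> b \<and> u i < a)"
    if "i < N" for i
    using abs_torus_in_per_interval[OF u[OF that] ab] u[OF that] by auto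
  obtain m where m: "m \<le> N" "\<forall>i<N. u i < a \<longleftrightarrow> i < m"
    using lt by blast
  obtain m' where m': "m' \<le> N" "\<forall>i<N. u i \<le> b \<longleftrightarrow> i < m'"
    using le by blast
  obtain m0 where m0: "m0 \<le> N" "\<forall>i<N. u i \<le> 0 \<longleftrightarrow> i < m0"
    using le by blast
  consider "a < b" "b = 1" | "a < b" "b < 1" | "b < a"
    using ab by force
  then show ?thesis
  proof cases
    \<comment> \<open>As \<open>b = 1\<close>, the interval contains the point \<open>0\<close>.
      Indices of points at \<open>0\<close>, which are those below \<open>m0\<close>, must be
      dropped from those with \<open>u i < a\<close>.\<close>
    case 1
    have "{i. i < N \<and> abs_torus (u i) \<notin> per_interval a b} = {m0..<m}"
    proof -
      have "abs_torus (u i) \<in> per_interval a b \<longleftrightarrow> i \<notin> {m0..<m}" if "i < N" for i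
        using mem[OF that] 1 m(2) m0(2) u[OF that] that by (auto simp: not_less)
      then show ?thesis
        using m(1) by auto
    qed
    with ex_arc_between[of m0 N m] m m0 \<open>0 < N\<close> show ?thesis
      by metis
  next
    case 2
    have "i < m'" if "i < m" for i
    proof -
      have "i < N"
        using that m(1) by simp
      with 2 that m(2) m'(2) show ?thesis
        by force
    qed
    then have "m \<le> m'"
      by (meson less_irrefl not_le_imp_less)
    moreover have "{i. i < N \<and> abs_torus (u i) \<notin> per_interval a b} = {..<m} \<union> {m'..<N}"
    proof -
      have "abs_torus (u i) \<in> per_interval a b \<longleftrightarrow> i \<notin> {..<m} \<union> {m'..<N}" if "i < N" for i
        using mem[OF that] 2 m(2) m'(2) that by (auto simp: not_less)
      then show ?thesis
        using m(1) by auto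
    qed
    ultimately show ?thesis
      using ex_arc_outside[of m m' N] m' \<open>0 < N\<close> by metis
  next
    case 3
    have "{i. i < N \<and> abs_torus (u i) \<notin> per_interval a b} = {m'..<m}"
    proof -
      have "abs_torus (u i) \<in> per_interval a b \<longleftrightarrow> i \<notin> {m'..<m}" if "i < N" for i
        using mem[OF that] 3 m(2) m'(2) that by (auto simp: not_less)
      then show ?thesis
        using m(1) by auto
    qed
    with ex_arc_between[of m' N m] m m' \<open>0 < N\<close> show ?thesis
      by metis
  qed
qed

text \<open>Sorting by representatives gives one enumeration that serves all intervals at once;
  points with equal values may come in any order.\<close>

lemma ex_cyclic_enumeration:
  fixes v :: "'a \<Rightarrow> torus"
  assumes "finite C" "C \<noteq> {}"
  shows "\<exists>p. bij_betw p {..<card C} C \<and> (\<forall>a b. a \<in> {0..1} \<and> b \<in> {0..1} \<and> a \<noteq> b \<longrightarrow>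
    (\<exists>k<card C. \<exists>l\<le>card C. {c\<in>C. v c \<notin> per_interval a b} = p ` arc (card C) k l))"
proof -
  have "\<forall>c. \<exists>x. x \<in> {0..<1} \<and> v c = abs_torus x"
    using ex_abs_torus by blast
  then obtain u where u: "\<And>c. u c \<in> {0..<1}" "\<And>c. v c = abs_torus (u c)"
    by metis
  obtain xs where xs: "set xs = C" "distinct xs"
    using assms finite_distinct_list by blast
  define ys where "ys = sort_key u xs"
  have ys: "set ys = C" "distinct ys" "sorted (map u ys)"
    using xs by (auto simp: ys_def)
  have N: "length ys = card C" "0 < card C"
    using ys assms by (auto simp: distinct_card[symmetric])
  have bij: "bij_betw ((!) ys) {..<card C} C"
    using ys N by (intro bij_betw_nth) auto
  moreover have "\<exists>k<card C. \<exists>l\<le>card C. {c\<in>C. v c \<notin> per_interval a b} = (!) ys ` arc (card C) k l"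
    if "a \<in> {0..1}" "b \<in> {0..1}" "a \<noteq> b" for a b
  proof -
    have "\<exists>k<card C. \<exists>l\<le>card C.
        {i. i < card C \<and> abs_torus (u (ys ! i)) \<notin> per_interval a b} = arc (card C) k l"
      by (rule per_interval_complement_arc)
        (use u N that sorted_nth_mono[OF ys(3)] in \<open>auto simp: N\<close>)
    moreover have "{c\<in>C. v c \<notin> per_interval a b} =
        (!) ys ` {i. i < card C \<and> abs_torus (u (ys ! i)) \<notin> per_interval a b}"
      using ys(1) N(1) by (auto simp: u(2) in_set_conv_nth)
    ultimately show ?thesis
      by metis
  qed
  ultimately show ?thesis
    by (intro exI[of _ "(!) ys"]) simp
qed

section \<open>Counting the traces of boxes\<close>

lemma per_box_trace_complement:
  assumes "C \<subseteq> ({..<d} \<rightarrow>\<^sub>E UNIV)"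
  shows "C - per_box d a b = (\<Union>i<d. {c\<in>C. c i \<notin> per_interval (a i) (b i)})"
proof -
  have "c \<in> per_box d a b \<longleftrightarrow> (\<forall>i<d. c i \<in> per_interval (a i) (b i))" if "c \<in> C" for c
    using assms that by (auto simp: per_box_def PiE_iff)
  then show ?thesis
    by auto
qed

text \<open>
  The bad sets miss a whole arc of length \<open>L\<close> in some coordinate; the hypothesis on \<open>L\<close> makes them
  at most half of all subsets. Any other trace is determined by \<open>d\<close> arcs shorter than \<open>L\<close>.
\<close>
lemma shattered_by_boxes_bound:
  assumes sh: "shatters (per_boxes d) C" and L: "1 \<le> L" "L \<le> card C" "d * card C \<le> 2 ^ (L - 1)"
  shows "2 ^ (card C - 1) \<le> (card C * L) ^ d"
proof -
  define N where "N = card C"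
  have fin: "finite C" and tr: "vc_trace (per_boxes d) C = Pow C"
    using sh by (auto simp: shatters_iff)
  have N: "0 < N"
    using L by (auto simp: N_def)
  then have "C \<noteq> {}"
    by (auto simp: N_def)
  \<comment> \<open>\<open>C\<close> itself is a trace, so some box contains it, and elements of
    boxes are extensional.\<close>
  have ext: "C \<subseteq> ({..<d} \<rightarrow>\<^sub>E UNIV)"
  proof -
    have "C \<in> vc_trace (per_boxes d) C"
      using tr by auto
    then show ?thesis
      by (auto simp: vc_trace_def per_boxes_def per_box_def PiE_iff)
  qed
  have "\<exists>p. \<forall>i. bij_betw (p i) {..<N} C \<and> (\<forall>a b. a \<in> {0..1} \<and> b \<in> {0..1} \<and> a \<noteq> b \<longrightarrow>
      (\<exists>k<N. \<exists>l\<le>N. {c\<in>C. c i \<notin> per_interval a b} = p i ` arc N k l))"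
    unfolding N_def by (intro choice allI ex_cyclic_enumeration fin \<open>C \<noteq> {}\<close>)
  then obtain p where "\<forall>i. bij_betw (p i) {..<N} C \<and> (\<forall>a b. a \<in> {0..1} \<and> b \<in> {0..1} \<and> a \<noteq> b \<longrightarrow>
      (\<exists>k<N. \<exists>l\<le>N. {c\<in>C. c i \<notin> per_interval a b} = p i ` arc N k l))" ..
  then have bij: "bij_betw (p i) {..<N} C"
    and p: "a \<in> {0..1} \<Longrightarrow> b \<in> {0..1} \<Longrightarrow> a \<noteq> b \<Longrightarrow>
      \<exists>k<N. \<exists>l\<le>N. {c\<in>C. c i \<notin> per_interval a b} = p i ` arc N k l" for i a b
    by blast+
  define bad where "bad = (\<Union>i<d. \<Union>k<N. Pow (C - p i ` arc N k L))"
  \<comment> \<open>\<open>f i\<close> codes the start and the length of the arc missed in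
    coordinate \<open>i\<close>; \<open>\<Phi> f\<close> recovers the trace from these arcs.
    \<open>F\<close> admits only lengths below \<open>L\<close>.\<close>
  define \<Phi> where "\<Phi> f = C - (\<Union>i<d. p i ` arc N (fst (f i)) (snd (f i)))" for f :: "nat \<Rightarrow> nat \<times> nat"
  define F where "F = (PiE {..<d} (\<lambda>_. {..<N} \<times> {..<L}))"
  have cover: "Pow C \<subseteq> bad \<union> \<Phi> ` F"
  proof
    fix A assume "A \<in> Pow C"
    then have "A \<in> vc_trace (per_boxes d) C"
      using tr by simp
    then obtain a b where ab: "per_endpoints d a b" "A = per_box d a b \<inter> C"
      by (auto simp: vc_trace_def per_boxes_def)
    have "\<forall>i\<in>{..<d}. \<exists>q. fst q < N \<and>
        {c\<in>C. c i \<notin> per_interval (a i) (b i)} = p i ` arc N (fst q) (snd q)"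
    proof
      fix i assume "i \<in> {..<d}"
      then obtain k l where "k < N" "{c\<in>C. c i \<notin> per_interval (a i) (b i)} = p i ` arc N k l"
        using p[of "a i" "b i" i] ab(1) unfolding per_endpoints_def by blast
      then show "\<exists>q. fst q < N \<and>
          {c\<in>C. c i \<notin> per_interval (a i) (b i)} = p i ` arc N (fst q) (snd q)"
        by (intro exI[of _ "(k, l)"]) simp
    qed
    from bchoice[OF this] obtain f where f: "\<forall>i\<in>{..<d}. fst (f i) < N \<and>
        {c\<in>C. c i \<notin> per_interval (a i) (b i)} = p i ` arc N (fst (f i)) (snd (f i))" ..
    have "C - per_box d a b = (\<Union>i<d. p i ` arc N (fst (f i)) (snd (f i)))"
      unfolding per_box_trace_complement[OF ext] using f by (intro SUP_cong) auto
    then have A: "A = \<Phi> f"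
      unfolding \<Phi>_def ab(2) by blast
    show "A \<in> bad \<union> \<Phi> ` F"
    proof (cases "\<exists>i<d. L \<le> snd (f i)")
      case True
      then obtain i where i: "i < d" "L \<le> snd (f i)"
        by auto
      have "A \<subseteq> C - p i ` arc N (fst (f i)) L"
        using i arc_mono[OF i(2), of N "fst (f i)"] unfolding A \<Phi>_def by blast
      then show ?thesis
        using i f unfolding bad_def by blast
    next
      case False
      have "A = \<Phi> (restrict f {..<d})"
        unfolding A \<Phi>_def by simp
      moreover have "restrict f {..<d} \<in> F"
        unfolding F_def using False f by (intro restrict_PiE_iff[THEN iffD2]) (auto simp: mem_Times_iff not_le)
      ultimately show ?thesis
        by blast
    qed
  qed
  have card_bad: "card bad \<le> d * (N * 2 ^ (N - L))"
  proof -
    have "card (Pow (C - p i ` arc N k L)) = 2 ^ (N - L)" if "k < N" for i k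
    proof -
      have sub: "p i ` arc N k L \<subseteq> C"
        using arc_subset[OF N] bij[of i] by (auto simp: bij_betw_def)
      have "inj_on (p i) (arc N k L)"
        using arc_subset[OF N] bij[of i] by (meson bij_betw_imp_inj_on inj_on_subset)
      then have "card (p i ` arc N k L) = L"
        using card_arc[OF that, of L] L by (simp add: card_image N_def)
      then show ?thesis
        using fin sub by (simp add: card_Pow card_Diff_subset finite_subset N_def)
    qed
    then have "card (\<Union>k<N. Pow (C - p i ` arc N k L)) \<le> N * 2 ^ (N - L)" for i
      using card_UN_le[of "{..<N}" "\<lambda>k. Pow (C - p i ` arc N k L)"] by auto
    then have "(\<Sum>i<d. card (\<Union>k<N. Pow (C - p i ` arc N k L))) \<le> (\<Sum>i<d. N * 2 ^ (N - L))"
      by (intro sum_mono)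
    then show ?thesis
      unfolding bad_def using card_UN_le[of "{..<d}" "\<lambda>i. \<Union>k<N. Pow (C - p i ` arc N k L)"] by simp
  qed
  have finF: "finite F" and cardF: "card F = (N * L) ^ d"
    by (auto simp: F_def card_PiE intro!: finite_PiE)
  have finbad: "finite bad"
    using fin by (auto simp: bad_def)
  have "2 ^ N = card (Pow C)"
    using fin by (simp add: card_Pow N_def)
  also have "\<dots> \<le> card (bad \<union> \<Phi> ` F)"
    using cover finbad finF by (intro card_mono) auto
  also have "\<dots> \<le> card bad + card F"
    using card_Un_le[of bad "\<Phi> ` F"] card_image_le[OF finF, of \<Phi>] by linarith
  also have "\<dots> \<le> (d * N) * 2 ^ (N - L) + (N * L) ^ d"
    using card_bad cardF by simp
  also have "(d * N) * 2 ^ (N - L) \<le> 2 ^ (L - 1) * 2 ^ (N - L)"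
    using L by (intro mult_right_mono) (auto simp: N_def)
  also have "2 ^ (L - 1) * 2 ^ (N - L) = (2::nat) ^ (N - 1)"
    using L by (subst power_add[symmetric]) (simp add: N_def)
  finally have "2 ^ N \<le> 2 ^ (N - 1) + (N * L) ^ d"
    by simp
  moreover have "(2::nat) ^ N = 2 ^ (N - 1) + 2 ^ (N - 1)"
    using N by (cases N) auto
  ultimately show ?thesis
    by (simp add: N_def)
qed

section \<open>Lower bound\<close>

text \<open>
  The cube cut out for \<open>A\<close> has all side lengths \<open>1 - 1 / K\<close>: in coordinate \<open>i\<close> it omits the arc
  \<open>(t i / K, (t i + 1) / K)\<close>.
\<close>
lemma shatters_per_cubesI:
  fixes v :: "nat \<Rightarrow> 'a \<Rightarrow> real"
  assumes "finite P" and v: "\<And>i p. i < d \<Longrightarrow> p \<in> P \<Longrightarrow> 0 < v i p \<and> v i p < K"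
    and sep: "\<And>A. A \<subseteq> P \<Longrightarrow> \<exists>t. (\<forall>i<d. 0 \<le> t i \<and> t i + 1 \<le> K) \<and>
      (\<forall>p\<in>P. p \<notin> A \<longleftrightarrow> (\<exists>i<d. t i < v i p \<and> v i p < t i + 1))"
  shows "\<exists>C. shatters (per_cubes d) C \<and> card C = card P"
proof -
  define q where "q p = (\<lambda>i\<in>{..<d}. abs_torus (v i p / K))" for p
  have "\<exists>h\<in>per_cubes d. \<forall>p\<in>P. q p \<in> h \<longleftrightarrow> p \<in> A" if "A \<subseteq> P" for A
  proof -
    obtain t where t: "\<And>i. i < d \<Longrightarrow> 0 \<le> t i \<and> t i + 1 \<le> K"
      and tA: "\<And>p. p \<in> P \<Longrightarrow> p \<notin> A \<longleftrightarrow> (\<exists>i<d. t i < v i p \<and> v i p < t i + 1)"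
      using sep[OF \<open>A \<subseteq> P\<close>] by blast
    \<comment> \<open>\<open>b i\<close> will lie below \<open>a i\<close>, so the interval wraps
      around and misses exactly the open arc from \<open>b i\<close> to \<open>a i\<close>.\<close>
    define a where "a i = (t i + 1) / K" for i
    define b where "b i = t i / K" for i
    have ab: "a i \<in> {0..1}" "b i \<in> {0..1}" "b i < a i" "per_length (a i) (b i) = 1 - 1 / K"
      if "i < d" for i
    proof -
      have "0 < K"
        using t[OF that] by linarith
      then show "a i \<in> {0..1}" "b i \<in> {0..1}" "b i < a i" "per_length (a i) (b i) = 1 - 1 / K"
        using t[OF that] by (auto simp: a_def b_def per_length_def field_simps)
    qed
    have "per_endpoints d a b"
      using ab unfolding per_endpoints_def by (metis less_irrefl)
    moreover have "\<forall>i<d. \<forall>j<d. per_length (a i) (b i) = per_length (a j) (b j)"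
      using ab(4) by simp
    ultimately have "per_box d a b \<in> per_cubes d"
      unfolding per_cubes_def by blast
    moreover have "q p \<in> per_box d a b \<longleftrightarrow> p \<in> A" if "p \<in> P" for p
    proof -
      have "abs_torus (v i p / K) \<in> per_interval (a i) (b i) \<longleftrightarrow> \<not> (t i < v i p \<and> v i p < t i + 1)"
        if "i < d" for i
      proof -
        have "0 < v i p" "v i p < K"
          using v that \<open>p \<in> P\<close> by auto
        then have "v i p / K \<in> {0..<1}" "v i p / K \<le> b i \<longleftrightarrow> v i p \<le> t i"
          "a i \<le> v i p / K \<longleftrightarrow> t i + 1 \<le> v i p"
          by (simp_all add: a_def b_def divide_le_cancel)
        then show ?thesis
          using abs_torus_in_per_interval[of "v i p / K" "a i" "b i"] ab(1-3)[OF that]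
          by (simp add: not_less de_Morgan_conj)
      qed
      then have "q p \<in> per_box d a b \<longleftrightarrow> (\<forall>i<d. \<not> (t i < v i p \<and> v i p < t i + 1))"
        by (auto simp: q_def per_box_def PiE_iff)
      then show ?thesis
        using tA[OF \<open>p \<in> P\<close>] by blast
    qed
    ultimately show ?thesis
      by blast
  qed
  then show ?thesis
    using shatters_image[of P "per_cubes d" q] \<open>finite P\<close> by blast
qed

section \<open>Union bound for random colourings\<close>

lemma Suc_power_ge: "c ^ Suc m + Suc m * c ^ m \<le> Suc c ^ Suc m"
\<comment> \<open>The left side consists of the two leading terms of the binomial expansion of the
  right side.\<close>
proof (induction m)
  case (Suc m)
  have "c ^ Suc (Suc m) + Suc (Suc m) * c ^ Suc m \<le> Suc c * (c ^ Suc m + Suc m * c ^ m)"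
    by (simp add: algebra_simps)
  also have "\<dots> \<le> Suc c * Suc c ^ Suc m"
    using Suc.IH by (rule mult_left_mono) simp
  finally show ?case
    by simp
qed simp

text \<open>Integer form of \<open>(1 - 1 / M) ^ M < 1 / 2\<close>: for \<open>M = c + 1\<close>,
  \<open>Suc_power_ge\<close> gives \<open>2 * c ^ M < M ^ M\<close>. The \<open>k\<close>-th power
  of this uses \<open>M * k\<close> of the \<open>e\<close> factors, and the remaining ones satisfy
  \<open>c \<le> M\<close>.\<close>

lemma two_power_mult_pred_power_less:
  fixes M k e :: nat
  assumes "0 < M" "0 < k" "M * k \<le> e"
  shows "2 ^ k * (M - 1) ^ e < M ^ e"
proof -
  obtain c where c: "M = Suc c"
    using assms(1) gr0_implies_Suc by blast
  \<comment> \<open>For \<open>c = 0\<close> this is \<open>0 ^ 0 = 1\<close>.\<close>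
  have "0 < c ^ c"
    by (cases c) auto
  then have base: "2 * c ^ Suc c < Suc c ^ Suc c"
  proof -
    have "2 * c ^ Suc c < c ^ Suc c + Suc c * c ^ c"
      using \<open>0 < c ^ c\<close> by simp
    also have "\<dots> \<le> Suc c ^ Suc c"
      by (rule Suc_power_ge)
    finally show ?thesis .
  qed
  have "2 ^ k * c ^ e = (2 * c ^ Suc c) ^ k * c ^ (e - M * k)"
    using assms(3) c by (simp add: power_mult_distrib power_mult[symmetric] power_add[symmetric] del: power_Suc)
  also have "\<dots> \<le> (2 * c ^ Suc c) ^ k * Suc c ^ (e - M * k)"
    by (intro mult_left_mono power_mono) auto
  also have "\<dots> < (Suc c ^ Suc c) ^ k * Suc c ^ (e - M * k)"
    using base assms(2) by (intro mult_strict_right_mono power_strict_mono) auto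
  also have "\<dots> = Suc c ^ e"
    using assms(3) c by (simp add: power_mult[symmetric] power_add[symmetric] del: power_Suc)
  finally show ?thesis
    by (simp add: c)
qed

text \<open>Each cell of \<open>J\<close> forbids exactly one value, independently of the others:
  for nonempty \<open>S\<close> and uniformly random \<open>B\<close> the event has probability
  \<open>(1 - 1 / card S) ^ card J\<close>.\<close>

lemma card_PiE_avoid:
  assumes "finite I" "J \<subseteq> I" "finite S" "\<And>q. q \<in> J \<Longrightarrow> a q \<in> S"
  shows "card {B \<in> I \<rightarrow>\<^sub>E S. \<forall>q\<in>J. B q \<noteq> a q} = (card S - 1) ^ card J * card S ^ (card I - card J)"
proof -
  have "{B \<in> I \<rightarrow>\<^sub>E S. \<forall>q\<in>J. B q \<noteq> a q} = (\<Pi>\<^sub>E q\<in>I. if q \<in> J then S - {a q} else S)"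
    using assms(2) by (fastforce simp: PiE_iff split: if_splits)
  moreover have "(\<Prod>q\<in>I. card (if q \<in> J then S - {a q} else S)) =
      (\<Prod>q\<in>I - J. card (if q \<in> J then S - {a q} else S)) * (\<Prod>q\<in>J. card (if q \<in> J then S - {a q} else S))"
    by (rule prod.subset_diff) (use assms in auto)
  moreover have "(\<Prod>q\<in>I - J. card (if q \<in> J then S - {a q} else S)) = (\<Prod>q\<in>I - J. card S)"
    by (rule prod.cong) auto
  moreover have "(\<Prod>q\<in>J. card (if q \<in> J then S - {a q} else S)) = (\<Prod>q\<in>J. card S - 1)"
    by (rule prod.cong) (use assms in \<open>auto simp: card_Diff_subset\<close>)
  moreover have "card (I - J) = card I - card J"
    using assms by (meson card_Diff_subset finite_subset)
  ultimately show ?thesis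
    using assms(1) by (simp add: card_PiE)
qed

lemma card_UN_bounded:
  fixes K :: nat
  assumes "finite A" "\<And>a. a \<in> A \<Longrightarrow> card (F a) \<le> K"
  shows "card (\<Union>a\<in>A. F a) \<le> card A * K"
proof -
  have "(\<Sum>a\<in>A. card (F a)) \<le> card A * K"
    using sum_bounded_above[of A "\<lambda>a. card (F a)" K] assms(2) by simp
  with card_UN_le[OF assms(1), of F] show ?thesis
    by (rule order_trans)
qed

text \<open>The union bound: a uniformly random colouring works with positive probability.\<close>
lemma ex_unavoidable_colouring:
  fixes n G x z :: nat and S :: "'c set"
  assumes "finite S" "S \<noteq> {}" and xz: "x \<le> G" "z \<le> n"
    and less: "2 ^ (G + n) * card S ^ x * (card S - 1) ^ (x * z) < card S ^ (x * z)"
  shows "\<exists>B. \<forall>X Z a. X \<subseteq> {..<G} \<and> Z \<subseteq> {..<n} \<and>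
    card X = x \<and> card Z = z \<and> a \<in> X \<rightarrow> S \<longrightarrow> (\<exists>i\<in>Z. \<exists>j\<in>X. B i j = a j)"
proof -
  define M where "M = card S"
  have "0 < M"
    using assms(1,2) by (auto simp: M_def card_gt_0_iff)
  define I where "I = {..<n} \<times> {..<G}"
  define \<Omega> where "\<Omega> = (I \<rightarrow>\<^sub>E S)"
  \<comment> \<open>The colourings that differ from the prescribed \<open>a\<close> on the whole
    rectangle. \<open>B\<close> is uncurried here, with the coordinate as the first component of a
    cell.\<close>
  define avoid where "avoid X Z a = {B \<in> \<Omega>. \<forall>q\<in>Z \<times> X. B q \<noteq> a (snd q)}" for X Z and a :: "nat \<Rightarrow> 'c"
  define \<X> where "\<X> = {X. X \<subseteq> {..<G} \<and> card X = x}"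
  define \<Z> where "\<Z> = {Z. Z \<subseteq> {..<n} \<and> card Z = z}"
  define Bad where "Bad = (\<Union>X\<in>\<X>. \<Union>Z\<in>\<Z>. \<Union>a\<in>X \<rightarrow>\<^sub>E S. avoid X Z a)"
  define K where "K = (M - 1) ^ (x * z) * M ^ (n * G - x * z)"
  have fin: "finite \<X>" "finite \<Z>" "finite I"
    by (auto simp: \<X>_def \<Z>_def I_def)
  have cI: "card I = n * G"
    by (simp add: I_def)
  have cX: "card \<X> \<le> 2 ^ G"
  proof -
    have "card \<X> \<le> card (Pow {..<G})"
      by (rule card_mono) (auto simp: \<X>_def)
    then show ?thesis
      by (simp add: card_Pow)
  qed
  have cZ: "card \<Z> \<le> 2 ^ n"
  proof -
    have "card \<Z> \<le> card (Pow {..<n})"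
      by (rule card_mono) (auto simp: \<Z>_def)
    then show ?thesis
      by (simp add: card_Pow)
  qed
  have card_avoid: "card (avoid X Z a) = K" if "X \<in> \<X>" "Z \<in> \<Z>" "a \<in> X \<rightarrow>\<^sub>E S" for X Z a
  proof -
    have "card (avoid X Z a) = (card S - 1) ^ card (Z \<times> X) * card S ^ (card I - card (Z \<times> X))"
      unfolding avoid_def \<Omega>_def
      by (rule card_PiE_avoid) (use fin that assms(1) in \<open>auto simp: I_def \<X>_def \<Z>_def\<close>)
    then show ?thesis
      using that by (simp add: K_def M_def cI \<X>_def \<Z>_def card_cartesian_product mult.commute)
  qed
  have card1: "card (\<Union>a\<in>X \<rightarrow>\<^sub>E S. avoid X Z a) \<le> M ^ x * K" if "X \<in> \<X>" "Z \<in> \<Z>" for X Z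
  proof -
    have "finite X" "card X = x"
      using that(1) by (auto simp: \<X>_def intro: finite_subset)
    then have "finite (X \<rightarrow>\<^sub>E S)" "card (X \<rightarrow>\<^sub>E S) = M ^ x"
      using assms(1) by (auto simp: card_PiE M_def intro!: finite_PiE)
    then show ?thesis
      using card_UN_bounded[of "X \<rightarrow>\<^sub>E S" "avoid X Z" K] card_avoid[OF that] by simp
  qed
  have card2: "card (\<Union>Z\<in>\<Z>. \<Union>a\<in>X \<rightarrow>\<^sub>E S. avoid X Z a) \<le> 2 ^ n * (M ^ x * K)" if "X \<in> \<X>" for X
  proof -
    have "card (\<Union>Z\<in>\<Z>. \<Union>a\<in>X \<rightarrow>\<^sub>E S. avoid X Z a) \<le> card \<Z> * (M ^ x * K)"
      by (rule card_UN_bounded[OF fin(2) card1[OF that]])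
    also have "\<dots> \<le> 2 ^ n * (M ^ x * K)"
      using cZ by (rule mult_right_mono) simp
    finally show ?thesis .
  qed
  have "card Bad \<le> card \<X> * (2 ^ n * (M ^ x * K))"
    unfolding Bad_def by (rule card_UN_bounded[OF fin(1) card2])
  also have "\<dots> \<le> 2 ^ G * (2 ^ n * (M ^ x * K))"
    using cX by (rule mult_right_mono) simp
  \<comment> \<open>\<open>2 ^ (G + n)\<close> bounds the choices of \<open>X\<close> and
    \<open>Z\<close>, and \<open>M ^ x\<close> counts those of \<open>a\<close>; the bracket is what
    the hypothesis \<open>less\<close> controls.\<close>
  also have "\<dots> = (2 ^ (G + n) * M ^ x * (M - 1) ^ (x * z)) * M ^ (n * G - x * z)"
    by (simp add: K_def power_add)
  also have "\<dots> < M ^ (x * z) * M ^ (n * G - x * z)"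
    using less \<open>0 < M\<close> by (intro mult_strict_right_mono) (auto simp: M_def)
  also have "\<dots> = card \<Omega>"
    using xz fin by (simp add: \<Omega>_def card_PiE cI M_def power_add[symmetric] mult_le_mono mult.commute[of n])
  finally have "card Bad < card \<Omega>" .
  moreover have "finite Bad"
  proof (rule finite_subset)
    show "Bad \<subseteq> \<Omega>"
      by (auto simp: Bad_def avoid_def)
    show "finite \<Omega>"
      using fin assms(1) by (auto simp: \<Omega>_def intro!: finite_PiE)
  qed
  ultimately obtain B where B: "B \<in> \<Omega>" "B \<notin> Bad"
    by (meson card_mono leD subsetI)
  have "\<exists>i\<in>Z. \<exists>j\<in>X. B (i, j) = a j"
    if "X \<subseteq> {..<G}" "Z \<subseteq> {..<n}" "card X = x" "card Z = z" "a \<in> X \<rightarrow> S" for X Z a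
  proof -
    have "X \<in> \<X>" "Z \<in> \<Z>" "restrict a X \<in> X \<rightarrow>\<^sub>E S"
      using that by (auto simp: \<X>_def \<Z>_def)
    then have "B \<notin> avoid X Z (restrict a X)"
      using B(2) unfolding Bad_def by blast
    then show ?thesis
      using B(1) by (auto simp: avoid_def)
  qed
  then show ?thesis
    by (intro exI[of _ "\<lambda>i j. B (i, j)"]) blast
qed

section \<open>Matching groups with coordinates\<close>

lemma ex_maximal_matching:
  assumes "finite J"
  shows "\<exists>Y f. Y \<subseteq> J \<and> inj_on f Y \<and> f ` Y \<subseteq> I \<and> (\<forall>j\<in>Y. E j (f j)) \<and>
    (\<forall>j\<in>J - Y. \<forall>i\<in>I - f ` Y. \<not> E j i)"
  using assms
proof (induction J)
  case (insert j J)
  then obtain Y f where *: "Y \<subseteq> J" "inj_on f Y" "f ` Y \<subseteq> I" "\<forall>j\<in>Y. E j (f j)"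
    "\<forall>j\<in>J - Y. \<forall>i\<in>I - f ` Y. \<not> E j i"
    by blast
  show ?case
  \<comment> \<open>Greedy choice: \<open>j\<close> is matched if it has a free partner. Otherwise
    it stays unmatched for good, since later steps only shrink the set of free
    \<open>i\<close>.\<close>
  proof (cases "\<exists>i\<in>I - f ` Y. E j i")
    case True
    then obtain i where i: "i \<in> I" "i \<notin> f ` Y" "E j i"
      by blast
    have "j \<notin> Y"
      using * insert.hyps by blast
    then have "(f(j := i)) ` Y = f ` Y"
      by auto
    then have img: "(f(j := i)) ` insert j Y = insert i (f ` Y)"
      by (simp only: image_insert fun_upd_same)
    have inj: "inj_on (f(j := i)) (insert j Y)"
      using i *(2) \<open>j \<notin> Y\<close> \<open>(f(j := i)) ` Y = f ` Y\<close> by (auto simp: inj_on_def)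
    show ?thesis
    proof (intro exI conjI)
      show "inj_on (f(j := i)) (insert j Y)"
        by (rule inj)
      show "\<forall>j'\<in>insert j J - insert j Y. \<forall>i'\<in>I - (f(j := i)) ` insert j Y. \<not> E j' i'"
        unfolding img using *(5) by blast
      show "\<forall>j'\<in>insert j Y. E j' ((f(j := i)) j')"
        using *(4) i by auto
      show "(f(j := i)) ` insert j Y \<subseteq> I"
        unfolding img using *(3) i by blast
    qed (use * in auto)
  next
    case False
    with * show ?thesis
      by (intro exI[of _ Y] exI[of _ f]) auto
  qed
qed auto

text \<open>\<open>G + z\<close> coordinates take part in the matching, and \<open>x * R\<close>
  further ones remove single points. Hypothesis \<open>xz\<close> is the condition
  \<open>M * k \<le> e\<close> of \<open>two_power_mult_pred_power_less\<close> with
  \<open>M = 2 ^ R\<close> and \<open>e = x * z\<close>, where \<open>2 ^ k\<close> bounds the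
  number of choices of \<open>X\<close>, \<open>Z\<close> and \<open>a\<close>.\<close>

lemma per_cubes_shatters_large:
  fixes R x z G d :: nat
  assumes "0 < R" "x \<le> G" "0 < G" and d: "G + z + x * R \<le> d"
    and xz: "2 ^ R * (2 * G + z + R * x) \<le> x * z"
  shows "\<exists>C. shatters (per_cubes d) C \<and> card C = G * R"
proof -
  define n where "n = G + z"
  define S where "S = Pow {..<R}"
  have card_S: "card S = 2 ^ R"
    by (simp add: S_def card_Pow)
  have "2 ^ (G + n) * card S ^ x * (card S - 1) ^ (x * z) < card S ^ (x * z)"
  proof -
    have "2 ^ (G + n + R * x) * (card S - 1) ^ (x * z) < card S ^ (x * z)"
      by (rule two_power_mult_pred_power_less)
        (use xz \<open>0 < G\<close> in \<open>simp_all add: card_S n_def mult_2 add.assoc\<close>)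
    then show ?thesis
      by (simp add: power_add power_mult card_S)
  qed
  moreover have "finite S" "S \<noteq> {}" "z \<le> n"
    by (auto simp: S_def n_def)
  ultimately obtain B where hit: "\<exists>i\<in>Z. \<exists>j\<in>X. B i j = a j"
    if "X \<subseteq> {..<G}" "Z \<subseteq> {..<n}" "card X = x" "card Z = z" "a \<in> X \<rightarrow> S" for X Z a
    using ex_unavoidable_colouring[of S x G z n] \<open>x \<le> G\<close> by metis
  define P where "P = {..<G} \<times> {..<R}"
  define idx where "idx p = fst p * R + snd p" for p
  \<comment> \<open>In a coordinate \<open>i < n\<close>, group \<open>j\<close> occupies the values
    \<open>2 * j + 1\<close> and \<open>2 * j + 3 / 2\<close>, the latter for points of
    \<open>B i j\<close>. The open unit window starting at \<open>2 * j + 1 / 2\<close> catches the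
    former and ends at the latter. In the other coordinates all points have distinct integer
    values.\<close>
  define v :: "nat \<Rightarrow> nat \<times> nat \<Rightarrow> real" where
    "v i p = (if i < n then 2 * real (fst p) + 1 + (if snd p \<in> B i (fst p) then 1 / 2 else 0) else 1 + real (idx p))" for i p
  \<comment> \<open>Exceeds all values of \<open>v\<close> and leaves room for every window end
    \<open>t i + 1\<close> used below.\<close>
  define K :: real where "K = 2 * real G + real G * real R + 2"
  have idx_less: "idx p < G * R" if "p \<in> P" for p
  proof -
    have "idx p < Suc (fst p) * R"
      using that by (auto simp: idx_def P_def)
    also have "\<dots> \<le> G * R"
      using that by (intro mult_right_mono) (auto simp: P_def)
    finally show ?thesis .
  qed
  have idx_inj: "idx p = idx p' \<longleftrightarrow> p = p'" if "p \<in> P" "p' \<in> P" for p p'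
  proof
    assume *: "idx p = idx p'"
    have "idx p div R = fst p" "idx p mod R = snd p" "idx p' div R = fst p'" "idx p' mod R = snd p'"
      using that by (auto simp: idx_def P_def)
    with * show "p = p'"
      by (metis prod_eqI)
  qed simp
  have v_bounds: "1 \<le> v i p" "v i p < K" if "p \<in> P" for i p
  proof -
    have "real (fst p) < real G" "real (idx p) < real (G * R)"
      using that idx_less[OF that] by (auto simp: P_def simp del: of_nat_mult)
    then show "1 \<le> v i p" "v i p < K"
      by (auto simp: v_def K_def)
  qed
  have "\<exists>t. (\<forall>i<d. 0 \<le> t i \<and> t i + 1 \<le> K) \<and>
      (\<forall>p\<in>P. p \<notin> A \<longleftrightarrow> (\<exists>i<d. t i < v i p \<and> v i p < t i + 1))" if "A \<subseteq> P" for A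
  proof -
    define a where "a j = {r. r < R \<and> (j, r) \<in> A}" for j
    from ex_maximal_matching[OF finite_lessThan, of G "{..<n}" "\<lambda>j i. B i j = a j"]
    obtain Y f where Y: "Y \<subseteq> {..<G}" and f: "inj_on f Y" "f ` Y \<subseteq> {..<n}" "\<forall>j\<in>Y. B (f j) j = a j"
      and unmatched: "\<forall>j\<in>{..<G} - Y. \<forall>i\<in>{..<n} - f ` Y. B i j \<noteq> a j"
      by (elim exE conjE)
    define X where "X = {..<G} - Y"
    have "finite Y"
      using Y by (rule finite_subset) simp
    have "card Y \<le> G"
      using card_mono[OF _ Y] by simp
    \<comment> \<open>With \<open>x\<close> unmatched groups and at least \<open>n - G = z\<close>
      free coordinates, \<open>hit\<close> would realise the trace of an unmatched group in a free
      coordinate, against maximality.\<close>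
    have "card X < x"
    proof (rule ccontr)
      assume "\<not> card X < x"
      then obtain X' where X': "X' \<subseteq> X" "card X' = x"
        by (meson not_less obtain_subset_with_card_n)
      have "card ({..<n} - f ` Y) = n - card Y"
        using f \<open>finite Y\<close> by (simp add: card_Diff_subset card_image)
      then have "z \<le> card ({..<n} - f ` Y)"
        using \<open>card Y \<le> G\<close> by (simp add: n_def)
      then obtain Z where Z: "Z \<subseteq> {..<n} - f ` Y" "card Z = z"
        by (meson obtain_subset_with_card_n)
      have "\<exists>i\<in>Z. \<exists>j\<in>X'. B i j = a j"
        by (rule hit) (use X' Z in \<open>auto simp: X_def S_def a_def\<close>)
      then show False
        using unmatched X'(1) Z(1) unfolding X_def by blast
    qed
    \<comment> \<open>The points still to be removed after the matching; \<open>g\<close> will give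
      each of them a coordinate of its own among \<open>n, ..., d - 1\<close>.\<close>
    define U where "U = {p \<in> P. fst p \<in> X \<and> p \<notin> A}"
    have "finite P"
      by (simp add: P_def)
    then have "finite U"
      by (simp add: U_def)
    have "card U \<le> card (X \<times> {..<R})"
      by (rule card_mono) (auto simp: U_def P_def X_def)
    also have "\<dots> \<le> x * R"
      using \<open>card X < x\<close> by (simp add: card_cartesian_product)
    also have "\<dots> \<le> card {n..<d}"
      using d by (simp add: n_def)
    finally obtain g where g: "inj_on g U" "g ` U \<subseteq> {n..<d}"
      using card_le_inj[OF \<open>finite U\<close>, of "{n..<d}"] by auto
    \<comment> \<open>A matched coordinate cuts at its group, a coordinate used by \<open>g\<close>
      at its single point. The default \<open>0\<close> opens the window from \<open>0\<close> to
      \<open>1\<close>, which catches nothing because \<open>v\<close> is at least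
      \<open>1\<close>.\<close>
    define t :: "nat \<Rightarrow> real" where "t i =
      (if i \<in> f ` Y then 2 * real (the_inv_into Y f i) + 1 / 2
       else if i \<in> g ` U then real (idx (the_inv_into U g i)) + 1 / 2 else 0)" for i
    have tf: "t (f j) = 2 * real j + 1 / 2" "f j < n" if "j \<in> Y" for j
      using that f by (auto simp: t_def the_inv_into_f_f)
    have tg: "t (g u) = real (idx u) + 1 / 2" "n \<le> g u" "g u < d" if "u \<in> U" for u
    proof -
      show "n \<le> g u" "g u < d"
        using that g by auto
      then have "g u \<notin> f ` Y"
        using f(2) by auto
      then show "t (g u) = real (idx u) + 1 / 2"
        using that g by (simp add: t_def the_inv_into_f_f)
    qed
    have t0: "t i = 0" if "i \<notin> f ` Y" "i \<notin> g ` U" for i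
      using that by (simp add: t_def)
    have bounds: "0 \<le> t i \<and> t i + 1 \<le> K" for i
    proof -
      consider j where "j \<in> Y" "i = f j" | u where "u \<in> U" "i = g u" | "i \<notin> f ` Y" "i \<notin> g ` U"
        by blast
      then show ?thesis
      proof cases
        case 1
        then have "real j < real G"
          using Y by auto
        moreover have "0 \<le> real G * real R"
          by simp
        ultimately show ?thesis
          unfolding K_def 1(2) tf(1)[OF 1(1)] by (intro conjI) linarith+
      next
        case 2
        then have "real (idx u) < real (G * R)"
          using idx_less[of u] by (simp add: U_def del: of_nat_mult)
        with 2 show ?thesis
          using tg(1)[of u] by (simp add: K_def)
      next
        case 3
        then show ?thesis
          using t0[of i] by (simp add: K_def)
      qed
    qed
    have cut: "p \<notin> A \<longleftrightarrow> (\<exists>i<d. t i < v i p \<and> v i p < t i + 1)" if "p \<in> P" for p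
    proof -
      have cut_f: "t (f j) < v (f j) p \<and> v (f j) p < t (f j) + 1 \<longleftrightarrow> j = fst p \<and> p \<notin> A"
        if "j \<in> Y" for j
      proof -
        have "snd p \<in> B (f j) (fst p) \<longleftrightarrow> p \<in> A" if "fst p = j"
        proof -
          have "B (f j) (fst p) = a (fst p)"
            using bspec[OF f(3) \<open>j \<in> Y\<close>] that by simp
          then show ?thesis
            using \<open>p \<in> P\<close> by (simp add: a_def P_def mem_Times_iff)
        qed
        note pattern = this
        show ?thesis
        proof (cases "fst p = j")
          case True
          with pattern show ?thesis
            unfolding v_def tf(1)[OF \<open>j \<in> Y\<close>] using tf(2)[OF \<open>j \<in> Y\<close>] by auto
        next
          case False
          then have "real j + 1 \<le> real (fst p) \<or> real (fst p) + 1 \<le> real j"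
            by linarith
          with False show ?thesis
            unfolding v_def tf(1)[OF \<open>j \<in> Y\<close>] using tf(2)[OF \<open>j \<in> Y\<close>] by auto
        qed
      qed
      have cut_g: "t (g u) < v (g u) p \<and> v (g u) p < t (g u) + 1 \<longleftrightarrow> u = p" if "u \<in> U" for u
      proof -
        have "t (g u) < v (g u) p \<and> v (g u) p < t (g u) + 1 \<longleftrightarrow> idx u = idx p"
          unfolding v_def tg(1)[OF that] using tg(2)[OF that] by auto
        then show ?thesis
          using idx_inj[of u p] that \<open>p \<in> P\<close> by (simp add: U_def)
      qed
      show ?thesis
      proof
        assume "p \<notin> A"
        show "\<exists>i<d. t i < v i p \<and> v i p < t i + 1"
        proof (cases "fst p \<in> Y")
          case True
          then have "f (fst p) < d"
            using tf(2)[OF True] d by (simp add: n_def)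
          with cut_f[OF True] \<open>p \<notin> A\<close> show ?thesis
            by blast
        next
          case False
          then have "p \<in> U"
            using \<open>p \<in> P\<close> \<open>p \<notin> A\<close> by (auto simp: U_def X_def P_def)
          with cut_g tg(3) show ?thesis
            by blast
        qed
      next
        assume "\<exists>i<d. t i < v i p \<and> v i p < t i + 1"
        then obtain i where i: "t i < v i p" "v i p < t i + 1"
          by blast
        then have "t i \<noteq> 0"
          using v_bounds(1)[OF that, of i] by auto
        then consider j where "j \<in> Y" "i = f j" | u where "u \<in> U" "i = g u"
          using t0 by blast
        then show "p \<notin> A"
        proof cases
          case 1
          with cut_f[of j] i show ?thesis
            by auto
        next
          case 2
          with cut_g[of u] i show ?thesis
            by (auto simp: U_def)
        qed
      qed
    qed
    from bounds cut show ?thesis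
      by blast
  qed
  moreover have "0 < v i p \<and> v i p < K" if "p \<in> P" for i p
    using v_bounds[OF that, of i] by auto
  moreover have "finite P" "card P = G * R"
    by (auto simp: P_def card_cartesian_product)
  ultimately show ?thesis
    using shatters_per_cubesI[of P d v K] by simp
qed

section \<open>Asymptotics\<close>

lemma per_cubes_subset: "per_cubes d \<subseteq> per_boxes d"
  by (auto simp: per_cubes_def per_boxes_def)

lemma per_cubes_nonempty: "per_cubes d \<noteq> {}"
proof -
  have "per_box d (\<lambda>_. 0) (\<lambda>_. 1) \<in> per_cubes d"
    unfolding per_cubes_def by (rule CollectI, intro exI conjI, rule refl) (auto simp: per_endpoints_def)
  then show ?thesis
    by blast
qed

text \<open>With \<open>N\<close> about \<open>d log d\<close> and \<open>L\<close> about
  \<open>3 log d\<close>, the logarithm of \<open>N * L\<close> is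
  \<open>log d + 2 log log d + O(1)\<close>. The coefficient \<open>3\<close> of
  \<open>log log d\<close> therefore suffices to contradict
  \<open>2 ^ (N - 1) \<le> (N * L) ^ d\<close>.\<close>

lemma eventually_shattered_by_boxes_bound:
  "\<forall>\<^sub>F d :: nat in at_top. \<forall>C. shatters (per_boxes d) C \<longrightarrow>
    card C \<le> nat \<lfloor>real d * (log 2 (real d) + 3 * log 2 (log 2 (real d)))\<rfloor>"
proof -
  define u :: "nat \<Rightarrow> real" where "u = (\<lambda>d. real d * (log 2 (real d) + 3 * log 2 (log 2 (real d))))"
  have "\<forall>\<^sub>F d in at_top. u d + 1 \<le> real d ^ 2"
    unfolding u_def by real_asymp
  moreover have "\<forall>\<^sub>F d in at_top. 3 * log 2 (real d) + 2 \<le> u d"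
    unfolding u_def by real_asymp
  moreover have "\<forall>\<^sub>F d in at_top. real d * log 2 ((u d + 1) * (3 * log 2 (real d) + 2)) < u d - 1"
    unfolding u_def by real_asymp
  ultimately show ?thesis
    using eventually_ge_at_top[of 2]
  proof eventually_elim
    case (elim d)
    \<comment> \<open>The least integer above \<open>u d\<close>. Shattering passes to subsets, so
      it is enough to exclude this one size.\<close>
    define N where "N = nat \<lfloor>u d\<rfloor> + 1"
    \<comment> \<open>\<open>N \<le> d ^ 2\<close> gives \<open>d * N \<le> d ^ 3\<close>, and
      \<open>L - 1\<close> is at least \<open>log 2 (d ^ 3)\<close>.\<close>
    define L where "L = nat \<lceil>3 * log 2 (real d)\<rceil> + 1"
    have "0 < log 2 (real d)"
      using elim(4) by simp
    then have L: "3 * log 2 (real d) \<le> real (L - 1)" "real L \<le> 3 * log 2 (real d) + 2" "1 \<le> L"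
      unfolding L_def by linarith+
    then have "0 \<le> u d"
      using elim(2) by linarith
    then have N: "real N \<le> u d + 1" "u d < real N" "u d - 1 \<le> real (N - 1)" "0 < N"
      unfolding N_def by linarith+
    have "real (d * N) \<le> real d * real d ^ 2"
      using order_trans[OF N(1) elim(1)] by (simp add: mult_left_mono)
    also have "\<dots> = real d powr 3"
      using elim(4) by (simp add: powr_numeral power3_eq_cube power2_eq_square)
    also have "\<dots> = 2 powr (3 * log 2 (real d))"
      using elim(4) by (simp add: mult.commute[of 3] powr_powr[symmetric])
    also have "\<dots> \<le> 2 powr real (L - 1)"
      using L(1) by simp
    also have "\<dots> = real (2 ^ (L - 1))"
      by (simp add: powr_realpow)
    finally have dN: "d * N \<le> 2 ^ (L - 1)"
      by (simp only: of_nat_le_iff)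
    have "real L \<le> real N"
      using L(2) N(2) elim(2) by linarith
    then have LN: "L \<le> N"
      by simp
    have pos: "0 < real (N * L)"
      using N(4) L(3) by simp
    have "real ((N * L) ^ d) = 2 powr (real d * log 2 (real (N * L)))"
      using pos by (simp add: mult.commute[of "real d"] powr_powr[symmetric] powr_realpow)
    also have "\<dots> \<le> 2 powr (real d * log 2 ((u d + 1) * (3 * log 2 (real d) + 2)))"
    proof -
      have "real (N * L) \<le> (u d + 1) * (3 * log 2 (real d) + 2)"
        using N(1) L(2) \<open>0 \<le> u d\<close> by (simp add: mult_mono)
      then show ?thesis
        using pos by (intro powr_mono mult_left_mono) auto
    qed
    also have "\<dots> < 2 powr real (N - 1)"
      using elim(3) N(3) by simp
    also have "\<dots> = real (2 ^ (N - 1))"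
      by (simp add: powr_realpow)
    finally have large: "(N * L) ^ d < 2 ^ (N - 1)"
      by (simp only: of_nat_less_iff)
    show ?case
    proof (intro allI impI)
      fix C assume C: "shatters (per_boxes d) C"
      have "card C < N"
      proof (rule ccontr)
        assume "\<not> card C < N"
        then obtain C' where C': "C' \<subseteq> C" "card C' = N"
          by (meson not_less obtain_subset_with_card_n)
        then have "2 ^ (card C' - 1) \<le> (card C' * L) ^ d"
          by (intro shattered_by_boxes_bound shatters_subset[OF C]) (use dN LN L(3) in auto)
        with C' large show False
          by simp
      qed
      then show "card C \<le> nat \<lfloor>real d * (log 2 (real d) + 3 * log 2 (log 2 (real d)))\<rfloor>"
        by (simp add: N_def u_def)
    qed
  qed
qed

lemma eventually_per_cubes_shatters:
  "\<forall>\<^sub>F d :: nat in at_top. \<exists>C. shatters (per_cubes d) C \<and>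
    real d * (log 2 (real d) - 4 * log 2 (log 2 (real d))) \<le> real (card C)"
proof -
  define l :: "nat \<Rightarrow> real" where "l = (\<lambda>d. log 2 (real d))"
  \<comment> \<open>Chosen so that \<open>2 powr \<rho> d = d / (8 * l d ^ 3)\<close>, which fits
    the requirement \<open>2 ^ R * (2 * d) \<le> x * z\<close> for \<open>x\<close> about
    \<open>d / l d ^ 2\<close> and \<open>z\<close> about \<open>d / l d\<close>. The
    \<open>8\<close> pays for the factor in \<open>2 * d\<close> and for halving both
    \<open>x\<close> and \<open>z\<close> in rounding.\<close>
  define \<rho> :: "nat \<Rightarrow> real" where "\<rho> = (\<lambda>d. l d - 3 * log 2 (l d) - 3)"
  have "\<forall>\<^sub>F d in at_top. 1 \<le> \<rho> d"
    unfolding l_def \<rho>_def by real_asymp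
  moreover have "\<forall>\<^sub>F d in at_top. 1 \<le> l d"
    unfolding l_def by real_asymp
  moreover have "\<forall>\<^sub>F d in at_top. real d / l d ^ 2 \<le> real d - 2 * (real d / l d)"
    unfolding l_def by real_asymp
  moreover have "\<forall>\<^sub>F d in at_top. 2 \<le> real d / l d ^ 2"
    unfolding l_def by real_asymp
  moreover have "\<forall>\<^sub>F d in at_top. real d * (l d - 4 * log 2 (l d)) \<le> (real d - 2 * (real d / l d)) * (\<rho> d - 1)"
    unfolding l_def \<rho>_def by real_asymp
  ultimately show ?thesis
    using eventually_gt_at_top[of 0]
  proof eventually_elim
    case (elim d)
    define R where "R = nat \<lfloor>\<rho> d\<rfloor>"
    define z where "z = nat \<lfloor>real d / l d\<rfloor>"
    define x where "x = nat \<lfloor>real d / l d ^ 2\<rfloor>"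
    \<comment> \<open>As \<open>R \<le> l d\<close>, both \<open>z\<close> and \<open>x * R\<close>
      are at most \<open>d / l d\<close>. Giving up these coordinates costs \<open>O(d)\<close>
      points, which the coefficient \<open>4\<close> in place of \<open>3\<close> absorbs.\<close>
    define G where "G = d - z - x * R"
    have R: "real R \<le> \<rho> d" "\<rho> d - 1 \<le> real R" "0 < R"
      using elim(1) unfolding R_def by linarith+
    have "0 \<le> log 2 (l d)"
      using elim(2) by simp
    then have "real R \<le> l d"
      using R(1) by (simp add: \<rho>_def)
    have x: "real x \<le> real d / l d ^ 2" "real d / l d ^ 2 - 1 \<le> real x"
      using elim(4) unfolding x_def by linarith+
    have "0 \<le> real d / l d"
      using elim(2) by simp
    then have z: "real z \<le> real d / l d" "real d / l d - 1 \<le> real z"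
      unfolding z_def by linarith+
    have "real x * real R \<le> real d / l d ^ 2 * l d"
      using x(1) \<open>real R \<le> l d\<close> elim(2) by (intro mult_mono) auto
    also have "\<dots> = real d / l d"
      using elim(2) by (simp add: power2_eq_square)
    finally have xR: "real (x * R) \<le> real d / l d"
      by simp
    have "real (z + x * R) \<le> real d"
      using xR z(1) elim(3,4) by simp
    then have zxR: "z + x * R \<le> d"
      by (simp only: of_nat_le_iff)
    then have "real G = real d - real z - real (x * R)"
      by (simp add: G_def of_nat_diff)
    then have G: "real d - 2 * (real d / l d) \<le> real G"
      using xR z(1) by linarith
    have "real x \<le> real G"
      using x(1) G elim(3) by linarith
    then have "x \<le> G"
      by simp
    have "0 < real G"
      using G elim(3,4) by linarith
    have "2 ^ R * (2 * G + z + R * x) \<le> x * z"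
    proof -
      have "2 * G + z + R * x \<le> 2 * d"
        using zxR by (simp add: G_def mult.commute[of R])
      then have "real (2 * G + z + R * x) \<le> 2 * real d"
        by linarith
      moreover have "2 ^ R \<le> real d / (8 * l d ^ 3)"
      proof -
        have "2 ^ R = 2 powr real R"
          by (simp add: powr_realpow)
        also have "\<dots> \<le> 2 powr \<rho> d"
          using R(1) by simp
        also have "\<dots> = real d / (8 * l d ^ 3)"
        proof -
          have "2 powr l d = real d"
            using elim(6) by (simp add: l_def)
          moreover have "2 powr (3 * log 2 (l d)) = l d ^ 3"
            using elim(2) by (simp add: mult.commute[of 3] powr_powr[symmetric] powr_numeral)
          ultimately show ?thesis
            by (simp add: \<rho>_def powr_diff)
        qed
        finally show ?thesis .
      qed
      ultimately have "2 ^ R * real (2 * G + z + R * x) \<le> real d / (8 * l d ^ 3) * (2 * real d)"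
        using elim(2) by (intro mult_mono) auto
      also have "\<dots> = real d ^ 2 / (4 * l d ^ 3)"
        by (simp add: power2_eq_square)
      also have "\<dots> = (real d / l d ^ 2 / 2) * (real d / l d / 2)"
        by (simp add: power2_eq_square power3_eq_cube)
      also have "\<dots> \<le> real x * real z"
      proof (rule mult_mono)
        \<comment> \<open>Rounding down a number that is at least \<open>2\<close> loses at most
          half of it.\<close>
        have half: "s / 2 \<le> t" if "s - 1 \<le> t" "2 \<le> s" for s t :: real
          using that by linarith
        show "real d / l d ^ 2 / 2 \<le> real x"
          using x(2) elim(4) by (rule half)
        have "l d * 1 \<le> l d * l d"
          using elim(2) by (intro mult_left_mono) auto
        then have "real d / l d ^ 2 \<le> real d / l d"
          using elim(2) by (intro divide_left_mono) (auto simp: power2_eq_square)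
        with elim(4) have "2 \<le> real d / l d"
          by (rule order_trans)
        with z(2) show "real d / l d / 2 \<le> real z"
          by (rule half)
      qed (use elim(2) in auto)
      finally have "real (2 ^ R * (2 * G + z + R * x)) \<le> real (x * z)"
        by simp
      then show ?thesis
        by (simp only: of_nat_le_iff)
    qed
    then obtain C where C: "shatters (per_cubes d) C" "card C = G * R"
      using per_cubes_shatters_large[of R x G z d] \<open>0 < real G\<close> \<open>x \<le> G\<close> R(3) zxR by (auto simp: G_def)
    have "real d * (l d - 4 * log 2 (l d)) \<le> (real d - 2 * (real d / l d)) * (\<rho> d - 1)"
      by (rule elim(5))
    also have "\<dots> \<le> real G * real R"
      using G R(2) elim(1,3,4) by (intro mult_mono) auto
    finally show ?case
      using C by (auto simp: l_def)
  qed
qed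

theorem theorem1p1:
  shows "(\<forall>\<^sub>F d :: nat in at_top.
            real d * (log 2 (real d) - 4 * log 2 (log 2 (real d))) \<le> real (VC (per_cubes d))
          \<and> VC (per_cubes d) \<le> VC (per_boxes d)
          \<and> real (VC (per_boxes d)) \<le> real d * (log 2 (real d) + 3 * log 2 (log 2 (real d))))
       \<and> (\<lambda>d. real (VC (per_boxes d))) \<sim>[at_top] (\<lambda>d. real (VC (per_cubes d)))
       \<and> (\<lambda>d. real (VC (per_cubes d))) \<sim>[at_top] (\<lambda>d. real d * log 2 (real d))"
proof -
  let ?l = "\<lambda>d. real d * (log 2 (real d) - 4 * log 2 (log 2 (real d)))"
  let ?u = "\<lambda>d. real d * (log 2 (real d) + 3 * log 2 (log 2 (real d)))"
  have pos: "\<forall>\<^sub>F d in at_top. 0 < real d * log 2 (real d)"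
    by real_asymp
  have "\<forall>\<^sub>F d in at_top. 0 \<le> ?u d"
    by real_asymp
  with eventually_shattered_by_boxes_bound eventually_per_cubes_shatters
  have bounds: "\<forall>\<^sub>F d in at_top. ?l d \<le> real (VC (per_cubes d)) \<and>
      VC (per_cubes d) \<le> VC (per_boxes d) \<and> real (VC (per_boxes d)) \<le> ?u d"
  proof eventually_elim
    case (elim d)
    have upper: "card C \<le> nat \<lfloor>?u d\<rfloor>" if "shatters (per_boxes d) C" for C
      using elim(1) that by blast
    \<comment> \<open>Ensures that \<open>VC (per_cubes d)\<close> is an actual maximum.\<close>
    have upper': "card C \<le> nat \<lfloor>?u d\<rfloor>" if "shatters (per_cubes d) C" for C
      using upper shatters_mono[OF that per_cubes_subset] by blast
    have "per_boxes d \<noteq> {}"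
      using per_cubes_subset[of d] per_cubes_nonempty[of d] by auto
    have mono: "VC (per_cubes d) \<le> VC (per_boxes d)"
      using per_cubes_subset per_cubes_nonempty upper by (rule VC_mono)
    obtain C where "shatters (per_cubes d) C" "?l d \<le> real (card C)"
      using elim(2) by blast
    moreover from this(1) have "card C \<le> VC (per_cubes d)"
      using upper' by (rule VC_ge)
    ultimately have "?l d \<le> real (VC (per_cubes d))"
      by linarith
    moreover have "VC (per_boxes d) \<le> nat \<lfloor>?u d\<rfloor>"
      using \<open>per_boxes d \<noteq> {}\<close> upper by (rule VC_le)
    then have "real (VC (per_boxes d)) \<le> ?u d"
      using elim(3) by linarith
    ultimately show ?case
      using mono by blast
  qed
  have l_lim: "(\<lambda>d. ?l d / (real d * log 2 (real d))) \<longlonglongrightarrow> 1"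
    by real_asymp
  have u_lim: "(\<lambda>d. ?u d / (real d * log 2 (real d))) \<longlonglongrightarrow> 1"
    by real_asymp
  \<comment> \<open>Since \<open>log log d = o(log d)\<close>, both explicit bounds are asymptotic
    to \<open>d log d\<close>, and so is everything between them.\<close>
  have asymp: "f \<sim>[at_top] (\<lambda>d. real d * log 2 (real d))"
    if "\<forall>\<^sub>F d in at_top. ?l d \<le> f d \<and> f d \<le> ?u d" for f :: "nat \<Rightarrow> real"
  proof (rule asymp_equivI', rule tendsto_sandwich[OF _ _ l_lim u_lim])
    show "\<forall>\<^sub>F d in at_top. ?l d / (real d * log 2 (real d)) \<le> f d / (real d * log 2 (real d))"
      using that pos by eventually_elim (rule divide_right_mono, blast, rule less_imp_le)
    show "\<forall>\<^sub>F d in at_top. f d / (real d * log 2 (real d)) \<le> ?u d / (real d * log 2 (real d))"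
      using that pos by eventually_elim (rule divide_right_mono, blast, rule less_imp_le)
  qed
  have cubes: "(\<lambda>d. real (VC (per_cubes d))) \<sim>[at_top] (\<lambda>d. real d * log 2 (real d))"
    by (rule asymp) (use bounds in \<open>eventually_elim; linarith\<close>)
  have boxes: "(\<lambda>d. real (VC (per_boxes d))) \<sim>[at_top] (\<lambda>d. real d * log 2 (real d))"
    by (rule asymp) (use bounds in \<open>eventually_elim; linarith\<close>)
  have "(\<lambda>d. real (VC (per_boxes d))) \<sim>[at_top] (\<lambda>d. real (VC (per_cubes d)))"
    using boxes asymp_equiv_symI[OF cubes] by (rule asymp_equiv_trans)
  with bounds cubes show ?thesis
    by blast
qed

end
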